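(* For all $n\ge0$, $$H_n\big(E_{2k+5}(1)\big)=\left(\frac12\right)^{n+1}\overline{\mathcal{H}}_{n+1}\cdot\prod_{\ell=1}^{n+1}\left(\frac{\ell^2(2\ell+1)(2\ell-1)}{4}\right)^{n+2-\ell},$$ where $E_j(x)$ are the Euler polynomials and $\overline{\mathcal{H}}_m:=\sum_{j=0}^m\frac{1}{2j+1}$.
   Context: For a sequence $(a_k)_{k\ge 0}$ and $n\ge 0$, $H_n(a_k):=\det(a_{i+j})_{0\le i,j\le n}$ denotes the $(n+1)\times(n+1)$ Hankel determinant; here the sequence is $(E_{2k+5}(1))_{k\ge0}$. The Euler polynomials are defined by $\frac{2e^{xt}}{e^t+1}=\sum_{n\ge0}E_n(x)\frac{t^n}{n!}$. *)

theory Defs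
  imports "Jordan_Normal_Form.Determinant"
    "HOL-Computational_Algebra.Polynomial"
    "HOL-Computational_Algebra.Formal_Power_Series"
begin

definition euler_gf :: "real \<Rightarrow> real fps" where
  "euler_gf x = 2 * fps_exp x / (fps_exp 1 + 1)"

text \<open>The value at \<open>x\<close> of the \<open>n\<close>-th Euler polynomial. The lemmas below confirm that it satisfies
  the generating function identity and is polynomial in \<open>x\<close>.\<close>
definition euler_poly :: "nat \<Rightarrow> real \<Rightarrow> real" where
  "euler_poly n x = fact n * fps_nth (euler_gf x) n"

lemma euler_poly_gf:
  "Abs_fps (\<lambda>n. euler_poly n x / fact n) * (fps_exp 1 + 1) = 2 * fps_exp x"
proof -
  have "Abs_fps (\<lambda>n. euler_poly n x / fact n) = euler_gf x"
    by (simp add: fps_eq_iff euler_poly_def)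
  moreover have "euler_gf x = 2 * fps_exp x * inverse (fps_exp 1 + 1)"
    unfolding euler_gf_def by (rule fps_divide_unit) simp
  moreover have "inverse (fps_exp 1 + 1) * (fps_exp 1 + 1 :: real fps) = 1"
    by (rule inverse_mult_eq_1) simp
  ultimately show ?thesis
    by (simp add: mult.assoc)
qed

lemma euler_poly_is_poly:
  "\<exists>p :: real poly. \<forall>x. poly p x = euler_poly n x"
proof -
  define c :: "real fps" where "c = 2 * inverse (fps_exp 1 + 1)"
  have gf: "euler_gf x = fps_exp x * c" for x
  proof -
    have "euler_gf x = 2 * fps_exp x * inverse (fps_exp 1 + 1)"
      unfolding euler_gf_def by (rule fps_divide_unit) simp
    then show ?thesis by (simp add: c_def mult_ac)
  qed
  let ?p = "\<Sum>i=0..n. monom (fact n * fps_nth c (n - i) / fact i) i"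
  have "poly ?p x = euler_poly n x" for x
    unfolding euler_poly_def gf fps_mult_nth sum_distrib_left poly_sum poly_monom
    by (rule sum.cong) simp_all
  then show ?thesis by blast
qed

definition hankel_det :: "nat \<Rightarrow> (nat \<Rightarrow> real) \<Rightarrow> real" where
  "hankel_det n a = det (mat (n + 1) (n + 1) (\<lambda>(i, j). a (i + j)))"

definition odd_harm :: "nat \<Rightarrow> real" where
  "odd_harm m = (\<Sum>j=0..m. 1 / (2 * real j + 1))"

end

(* Since 2e^t/(e^t+1) = 1 + tanh(t/2) and u = tanh(t/2) satisfies u' = (1 - u^2)/2, the values
   E_m(1), m > 0, are obtained by iterating D = ((1 - X^2)/2) d/dX on X and evaluating at 0.
   On odd polynomials D^2 is tridiagonal in the basis X^(2k+1). Expanding D^(2j) X in this basis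
   factors the Hankel matrix of E_(2k+1)(1) as lower times upper triangular with explicit
   diagonals. Deleting its first row and column gives the Hankel matrix of E_(2k+5)(1), so by
   Cramer's rule only the top left entry of the inverse is needed. It is 2 times the sum of the
   1/(2k+1): the first column of the inverse of the lower factor comes from the truncated series
   t = 2 artanh u, on which D^2 vanishes up to high order, and the first row of the inverse of the
   upper factor is constant because D p always vanishes at the fixed point X = 1. *)
theory Submission
  imports Defs "HOL-Computational_Algebra.Polynomial_FPS"
begin

section \<open>The derivation \<open>tanh_deriv\<close> on polynomials\<close>

definition tanh_deriv :: "real poly \<Rightarrow> real poly" where
  "tanh_deriv p = smult (1/2) ([:1, 0, -1:] * pderiv p)"

lemma tanh_deriv_sum: "tanh_deriv (\<Sum>x\<in>A. f x) = (\<Sum>x\<in>A. tanh_deriv (f x))"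
  by (induction A rule: infinite_finite_induct)
    (simp_all add: tanh_deriv_def pderiv_add smult_add_right ring_distribs)

lemma tanh_deriv_pow_sum:
  "(tanh_deriv ^^ n) (\<Sum>x\<in>A. f x) = (\<Sum>x\<in>A. (tanh_deriv ^^ n) (f x))"
  by (induction n) (simp_all add: tanh_deriv_sum)

lemma tanh_deriv_smult: "tanh_deriv (smult c p) = smult c (tanh_deriv p)"
  unfolding tanh_deriv_def pderiv_smult mult_smult_right smult_smult by (simp only: mult.commute)

lemma tanh_deriv_pow_smult:
  "(tanh_deriv ^^ n) (smult c p) = smult c ((tanh_deriv ^^ n) p)"
  by (induction n) (simp_all add: tanh_deriv_smult)

lemma coeff_tanh_deriv:
  "coeff (tanh_deriv p) i =
    (real (i + 1) * coeff p (i + 1) - (if i = 0 then 0 else real (i - 1) * coeff p (i - 1))) / 2"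
proof -
  have "tanh_deriv p = smult (1/2) (pderiv p - pCons 0 (pCons 0 (pderiv p)))"
    unfolding tanh_deriv_def by (rule arg_cong [where f = "smult (1/2)"]) simp
  then show ?thesis
    by (cases i; cases "i - 1") (simp_all add: coeff_pderiv coeff_pCons)
qed

lemma poly_tanh_deriv_one: "poly (tanh_deriv p) 1 = 0"
  by (simp add: tanh_deriv_def)

lemma coeff_tanh_deriv_pow_X_high:
  "n + 1 < i \<Longrightarrow> coeff ((tanh_deriv ^^ n) [:0, 1:]) i = 0"
  by (induction n arbitrary: i)
    (simp_all add: coeff_tanh_deriv coeff_pCons split: nat.splits)

text \<open>Only the part -X^2/2 d/dX raises the degree, and it multiplies the leading coefficient
  in degree m by -m/2. This supplies the diagonal of \<open>U\<close>.\<close>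

lemma coeff_tanh_deriv_pow_X_top:
  "coeff ((tanh_deriv ^^ n) [:0, 1:]) (n + 1) = (-1/2) ^ n * fact n"
proof (induction n)
  case (Suc n)
  have "coeff ((tanh_deriv ^^ n) [:0, 1:]) (n + 3) = 0"
    by (rule coeff_tanh_deriv_pow_X_high) simp
  moreover have "Suc n + 1 + 1 = n + 3" "Suc n + 1 - 1 = n + 1" by simp_all
  ultimately have "coeff ((tanh_deriv ^^ Suc n) [:0, 1:]) (Suc n + 1) =
      - (real (n + 1) * ((-1/2) ^ n * fact n)) / 2"
    by (simp only: funpow.simps o_apply coeff_tanh_deriv Suc.IH) simp
  then show ?case by simp
qed simp

lemma coeff_tanh_deriv_pow_X_parity:
  "even (n + i) \<Longrightarrow> coeff ((tanh_deriv ^^ n) [:0, 1:]) i = 0"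
proof (induction n arbitrary: i)
  case (Suc n)
  then have "coeff ((tanh_deriv ^^ n) [:0, 1:]) (i + 1) = 0"
    "i \<noteq> 0 \<Longrightarrow> coeff ((tanh_deriv ^^ n) [:0, 1:]) (i - 1) = 0"
    by simp_all
  then show ?case by (simp add: coeff_tanh_deriv)
qed (auto simp: coeff_pCons split: nat.splits)

text \<open>Each step lowers the order of vanishing at 0 by at most one, and only d/dX/2 acts on the
  lowest term. This gives the shape and diagonal of \<open>L\<close>, and later disposes of the
  truncation error.\<close>

lemma coeff_tanh_deriv_pow_zero:
  assumes "\<And>l. l < m \<Longrightarrow> coeff p l = 0"
  shows "coeff ((tanh_deriv ^^ m) p) 0 = fact m / 2 ^ m * coeff p m"
  using assms
proof (induction m arbitrary: p)
  case (Suc m)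
  have "coeff (tanh_deriv p) l = 0" if "l < m" for l
    using that Suc.prems by (simp add: coeff_tanh_deriv)
  then have "coeff ((tanh_deriv ^^ m) (tanh_deriv p)) 0 =
      fact m / 2 ^ m * coeff (tanh_deriv p) m"
    by (rule Suc.IH)
  moreover have "coeff (tanh_deriv p) m = real (m + 1) * coeff p (Suc m) / 2"
    using Suc.prems by (simp add: coeff_tanh_deriv)
  ultimately show ?case
    by (simp add: funpow_swap1 field_simps)
qed simp

lemma tanh_deriv_monom:
  "tanh_deriv (monom c (Suc m)) =
    monom (c * real (Suc m) / 2) m - monom (c * real (Suc m) / 2) (m + 2)"
  by (rule poly_eqI) (auto simp: coeff_tanh_deriv)

text \<open>The k-th term is sent to X^(2k) - X^(2k+2), so the sum telescopes.\<close>

lemma tanh_deriv_truncated_artanh: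
  "tanh_deriv (\<Sum>k\<le>N. monom (2 / (2 * real k + 1)) (2 * k + 1)) = 1 - monom 1 (2 * N + 2)"
proof -
  have "tanh_deriv (monom (2 / (2 * real k + 1)) (2 * k + 1)) =
      monom 1 (2 * k) - monom 1 (2 * k + 2)" for k
  proof -
    have "2 / (2 * real k + 1) * real (Suc (2 * k)) / 2 = 1"
      by (simp add: field_simps)
    then show ?thesis
      using tanh_deriv_monom [of "2 / (2 * real k + 1)" "2 * k"] by (simp del: of_nat_Suc)
  qed
  then have "tanh_deriv (\<Sum>k\<le>N. monom (2 / (2 * real k + 1)) (2 * k + 1)) =
      (\<Sum>k\<le>N. monom 1 (2 * k) - monom 1 (2 * Suc k))"
    by (simp add: tanh_deriv_sum)
  also have "\<dots> = 1 - monom 1 (2 * N + 2)"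
    by (subst sum_telescope) (simp add: monom_0)
  finally show ?thesis .
qed

section \<open>Euler polynomial values at 1 as iterated derivatives\<close>

lemma fps_deriv_euler_gf_one:
  defines "T \<equiv> euler_gf 1 - 1"
  shows "fps_deriv T = fps_const (1/2) * (1 - T\<^sup>2)" and "fps_nth T 0 = 0"
proof -
  let ?e = "fps_exp 1 :: real fps"
  have nz: "fps_nth (?e + 1) 0 \<noteq> 0" by simp
  have "euler_gf 1 = 2 * ?e * inverse (?e + 1)"
    unfolding euler_gf_def by (rule fps_divide_unit) (rule nz)
  moreover have "inverse (?e + 1) * (?e + 1) = 1"
    by (rule inverse_mult_eq_1) (rule nz)
  ultimately have "euler_gf 1 * (?e + 1) = 2 * ?e"
    by (simp add: mult.assoc)
  then have T: "T * (?e + 1) = ?e - 1"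
    by (simp add: T_def algebra_simps)
  then have "fps_deriv (T * (?e + 1)) = fps_deriv (?e - 1)" by simp
  then have dT: "fps_deriv T * (?e + 1) = ?e - T * ?e"
    by (simp add: algebra_simps)
  have "2 * (fps_deriv T * (?e + 1)\<^sup>2) = 2 * ((?e - T * ?e) * (?e + 1))"
    using dT by (simp add: power2_eq_square mult.assoc [symmetric])
  also have "\<dots> = 2 * (?e * (?e + 1) - T * (?e + 1) * ?e)"
    by (simp add: algebra_simps)
  \<comment> \<open>After \<open>T\<close> is eliminated both sides equal 4
    \<open>?e\<close>.\<close>
  also have "\<dots> = (?e + 1)\<^sup>2 - (T * (?e + 1))\<^sup>2"
    unfolding T by (simp add: algebra_simps power2_eq_square)
  also have "\<dots> = (1 - T\<^sup>2) * (?e + 1)\<^sup>2"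
    by (simp add: power_mult_distrib left_diff_distrib)
  finally have "(2 * fps_deriv T) * (?e + 1)\<^sup>2 = (1 - T\<^sup>2) * (?e + 1)\<^sup>2"
    by (simp add: mult.assoc)
  moreover have "(?e + 1)\<^sup>2 \<noteq> 0" using nz by (metis fps_zero_nth power_eq_0_iff)
  ultimately have "2 * fps_deriv T = 1 - T\<^sup>2" by simp
  moreover have "fps_const (1/2) * (2 * fps_deriv T) = fps_deriv T"
    by (simp add: fps_eq_iff numeral_fps_const)
  ultimately show "fps_deriv T = fps_const (1/2) * (1 - T\<^sup>2)" by simp
  have "fps_nth (T * (?e + 1)) 0 = fps_nth (?e - 1) 0" using T by simp
  then show "fps_nth T 0 = 0" by simp
qed

text \<open>By the chain rule and the differential equation of \<open>T\<close>, composition with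
  \<open>T\<close> turns \<open>tanh_deriv\<close> into d/dt.\<close>

lemma fps_nth_compose_tanh:
  defines "T \<equiv> euler_gf 1 - 1"
  shows "fact m * fps_nth (fps_of_poly p oo T) m = coeff ((tanh_deriv ^^ m) p) 0"
proof (induction m arbitrary: p)
  case 0
  then show ?case by simp
next
  case (Suc m)
  note T = fps_deriv_euler_gf_one [folded T_def]
  have "fps_of_poly [:1, 0, -1 :: real:] = 1 - fps_X\<^sup>2"
    by (auto simp: fps_eq_iff coeff_pCons fps_X_power_nth numeral_2_eq_2 split: nat.split)
  then have "fps_of_poly [:1, 0, -1:] oo T = (1 - fps_X\<^sup>2) oo T" by (rule arg_cong)
  also have "\<dots> = 1 - T\<^sup>2"
    using T(2) by (simp add: fps_compose_sub_distrib power2_eq_square fps_compose_mult_distrib)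
  finally have "fps_of_poly [:1, 0, -1:] oo T = 1 - T\<^sup>2" .
  moreover have "fps_deriv (fps_of_poly p oo T) = (fps_of_poly (pderiv p) oo T) * fps_deriv T"
    by (simp add: fps_compose_deriv [OF T(2)] fps_of_poly_pderiv)
  ultimately have deriv: "fps_of_poly (tanh_deriv p) oo T = fps_deriv (fps_of_poly p oo T)"
    unfolding tanh_deriv_def T(1) fps_of_poly_smult fps_of_poly_mult
    using T(2) by (simp add: fps_compose_mult_distrib mult_ac)
  have "fact (Suc m) * fps_nth (fps_of_poly p oo T) (Suc m) =
      fact m * fps_nth (fps_deriv (fps_of_poly p oo T)) m"
    by (simp add: algebra_simps)
  also have "\<dots> = coeff ((tanh_deriv ^^ m) (tanh_deriv p)) 0"
    using Suc.IH [of "tanh_deriv p"] deriv by simp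
  finally show ?case by (simp add: funpow_swap1)
qed

text \<open>The generating function is 1 + \<open>T\<close>; the summand 1 affects only index 0,
  which is why that index is excluded.\<close>

lemma euler_poly_one_eq:
  assumes "m \<noteq> 0"
  shows "euler_poly m 1 = coeff ((tanh_deriv ^^ m) [:0, 1:]) 0"
  using fps_nth_compose_tanh [of m "[:0, 1:]"] fps_deriv_euler_gf_one(2) assms
  by (simp add: euler_poly_def)

section \<open>Minors of a factored matrix\<close>

text \<open>Cramer's rule for the top left entry of the inverse of \<open>L * U\<close>: the hypotheses describe
  the first column of \<open>L\<^sup>-\<^sup>1\<close> and the first row of \<open>U\<^sup>-\<^sup>1\<close>.\<close>
lemma det_mat_delete_mult:
  fixes L U :: "'a :: field mat"
  assumes L: "L \<in> carrier_mat n n" and U: "U \<in> carrier_mat n n" and n: "0 < n"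
    and x: "x \<in> carrier_vec n" and y: "y \<in> carrier_vec n" and "det U \<noteq> 0"
    and Lx: "L *\<^sub>v x = unit_vec n 0" and Uy: "transpose_mat U *\<^sub>v y = unit_vec n 0"
  shows "det (mat_delete (L * U) 0 0) = det (L * U) * (y \<bullet> x)"
proof -
  \<comment> \<open>This is the inverse of \<open>U\<close> applied to \<open>x\<close>, so that
    \<open>L * U\<close> maps it to the first unit vector.\<close>
  define v where "v = (1 / det U) \<cdot>\<^sub>v (adj_mat U *\<^sub>v x)"
  note adj_U = adj_mat[OF U]
  have LU: "L * U \<in> carrier_mat n n" using L U by simp
  note adj_LU = adj_mat[OF LU]
  have v: "v \<in> carrier_vec n" using adj_U(1) x by (auto simp: v_def)
  have "U *\<^sub>v v = (1 / det U) \<cdot>\<^sub>v ((U * adj_mat U) *\<^sub>v x)"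
    using U adj_U(1) x by (simp add: v_def mult_mat_vec[of _ n n])
  also have "\<dots> = x"
    using adj_U(2) x \<open>det U \<noteq> 0\<close> by (intro eq_vecI) auto
  finally have Uv: "U *\<^sub>v v = x" .
  have "adj_mat (L * U) *\<^sub>v unit_vec n 0 = adj_mat (L * U) *\<^sub>v ((L * U) *\<^sub>v v)"
    using L U v Uv Lx by simp
  also have "\<dots> = (adj_mat (L * U) * (L * U)) *\<^sub>v v"
    using adj_LU(1) LU v by simp
  also have "\<dots> = det (L * U) \<cdot>\<^sub>v v"
    using adj_LU(3) v by (intro eq_vecI) auto
  finally have "(adj_mat (L * U) *\<^sub>v unit_vec n 0) $ 0 = det (L * U) * v $ 0"
    using v n by simp
  moreover have "(adj_mat (L * U) *\<^sub>v unit_vec n 0) $ 0 = adj_mat (L * U) $$ (0, 0)"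
    using adj_LU(1) n by simp
  moreover have "adj_mat (L * U) $$ (0, 0) = det (mat_delete (L * U) 0 0)"
    using L U n by (simp add: adj_mat_def cofactor_def)
  moreover have "v $ 0 = unit_vec n 0 \<bullet> v"
    using v n by simp
  \<comment> \<open>Moving the transpose across: (\<open>U\<close>^T \<open>y\<close>) .
    \<open>v\<close> = \<open>y\<close> . (\<open>U\<close> \<open>v\<close>).\<close>
  moreover have "\<dots> = y \<bullet> x"
    using transpose_vec_mult_scalar[OF U v y] Uy Uv by simp
  ultimately show ?thesis by simp
qed

lemma hankel_det_shift:
  "hankel_det n (\<lambda>k. a (k + 2)) = det (mat_delete (mat (n + 2) (n + 2) (\<lambda>(i, j). a (i + j))) 0 0)"
proof -
  have "mat (n + 1) (n + 1) (\<lambda>(i, j). a (i + j + 2)) =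
      mat_delete (mat (n + 2) (n + 2) (\<lambda>(i, j). a (i + j))) 0 0"
    by (rule eq_matI) (auto simp: mat_delete_def)
  then show ?thesis by (simp add: hankel_det_def)
qed

section \<open>Rewriting the product on the right-hand side\<close>

text \<open>The l-th factor is ((2l-1)(2l)) ((2l)(2l+1)) / 16, so both factorials build up two
  factors at a time.\<close>

lemma prod_hankel_coeff_eq:
  "(\<Prod>l=1..k. (real l)\<^sup>2 * (2 * real l + 1) * (2 * real l - 1) / 4) =
    fact (2 * k) * fact (2 * k + 1) / 16 ^ k"
proof (induction k)
  case (Suc k)
  have "fact (2 * Suc k) = (2 * real k + 2) * (2 * real k + 1) * fact (2 * k)"
    "fact (2 * Suc k + 1) = (2 * real k + 3) * (2 * real k + 2) * fact (2 * k + 1)"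
    by (simp_all add: algebra_simps)
  with Suc show ?case
    by (simp add: power2_eq_square field_simps)
qed simp

text \<open>The factor \<open>f l\<close> occurs in the inner products with k = l, ..., N, that is N
  + 1 - l times.\<close>

lemma prod_power_staircase:
  fixes f :: "nat \<Rightarrow> 'a :: comm_monoid_mult"
  shows "(\<Prod>l=1..N. f l ^ (N + 1 - l)) = (\<Prod>k\<le>N. \<Prod>l=1..k. f l)"
proof (induction N)
  case (Suc N)
  have "(\<Prod>l=1..Suc N. f l ^ (Suc N + 1 - l)) =
      (\<Prod>l=1..N. f l * f l ^ (N + 1 - l)) * f (Suc N)"
    by (simp add: Suc_diff_le)
  then show ?case using Suc by (simp add: prod.distrib mult_ac)
qed simp

section \<open>The triangular factorization and the determinant\<close>

theorem proposition5p1: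
  fixes n :: nat
  shows "hankel_det n (\<lambda>k. euler_poly (2 * k + 5) 1) =
    (1 / 2) ^ (n + 1) * odd_harm (n + 1) *
    (\<Prod>l=1..n + 1. ((real l)\<^sup>2 * (2 * real l + 1) * (2 * real l - 1) / 4) ^ (n + 2 - l))"
proof -
  let ?D = tanh_deriv
  let ?X = "[:0, 1:] :: real poly"
  define a where "a = (\<lambda>k. euler_poly (2 * k + 1) 1)"
  \<comment> \<open>The undeleted matrix has size n + 2 = \<open>Suc N\<close>.\<close>
  define N where "N = n + 1"
  \<comment> \<open>\<open>b\<close> holds the coordinates of the even iterates on X;
    \<open>c\<close> applies the remaining odd number of steps to each basis monomial and evaluates
    at 0.\<close>
  define b where "b = (\<lambda>k j. coeff ((?D ^^ (2 * j)) ?X) (2 * k + 1))"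
  define c where "c = (\<lambda>i k. coeff ((?D ^^ (2 * i + 1)) (monom 1 (2 * k + 1))) 0)"
  define L where "L = mat (Suc N) (Suc N) (\<lambda>(i, k). c i k)"
  define U where "U = mat (Suc N) (Suc N) (\<lambda>(k, j). b k j)"
  define x where "x = vec (Suc N) (\<lambda>k. 2 / (2 * real k + 1))"
  define y where "y = vec (Suc N) (\<lambda>_. 1 :: real)"
  have L: "L \<in> carrier_mat (Suc N) (Suc N)" and U: "U \<in> carrier_mat (Suc N) (Suc N)"
    and x: "x \<in> carrier_vec (Suc N)" and y: "y \<in> carrier_vec (Suc N)"
    by (simp_all add: L_def U_def x_def y_def)
  have b_zero: "b k j = 0" if "j < k" for k j
    unfolding b_def by (rule coeff_tanh_deriv_pow_X_high) (use that in simp)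
  have b_diag: "b k k = fact (2 * k) / 4 ^ k" for k
    using coeff_tanh_deriv_pow_X_top [of "2 * k"]
    by (simp add: b_def power_mult power_divide)
  have c_zero: "c i k = 0" if "i < k" for i k
    unfolding c_def by (subst coeff_tanh_deriv_pow_zero) (use that in auto)
  have c_diag: "c k k = fact (2 * k + 1) / (2 * 4 ^ k)" for k
    unfolding c_def by (subst coeff_tanh_deriv_pow_zero) (auto simp: power_mult)
  \<comment> \<open>Cutting the sum at \<open>N\<close> loses nothing, since the degree is at most
    2j + 1; parity removes the even monomials.\<close>
  have expand: "(?D ^^ (2 * j)) ?X = (\<Sum>k\<le>N. smult (b k j) (monom 1 (2 * k + 1)))"
    if "j \<le> N" for j
  proof (rule poly_eqI)
    fix i
    have *: "coeff (\<Sum>k\<le>N. smult (b k j) (monom 1 (2 * k + 1))) i =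
        (\<Sum>k\<le>N. if 2 * k + 1 = i then b k j else 0)"
      by (simp add: coeff_sum if_distrib cong: if_cong)
    show "coeff ((?D ^^ (2 * j)) ?X) i =
        coeff (\<Sum>k\<le>N. smult (b k j) (monom 1 (2 * k + 1))) i"
    proof (cases "odd i")
      case True
      then obtain k where i: "i = 2 * k + 1" by (auto elim: oddE)
      have "(\<Sum>k'\<le>N. if 2 * k' + 1 = i then b k' j else 0) = (if k \<le> N then b k j else 0)"
        by (simp add: i)
      also have "\<dots> = b k j" using b_zero that by auto
      finally show ?thesis unfolding * by (simp add: i b_def)
    next
      case False
      then have "(\<Sum>k\<le>N. if 2 * k + 1 = i then b k j else 0) = 0"
        by (intro sum.neutral) auto
      then show ?thesis
        unfolding * using False by (simp add: coeff_tanh_deriv_pow_X_parity)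
    qed
  qed
  have hankel: "mat (n + 2) (n + 2) (\<lambda>(i, j). a (i + j)) = L * U"
  proof (rule eq_matI)
    fix i j assume "i < dim_row (L * U)" "j < dim_col (L * U)"
    then have ij: "i \<le> N" "j \<le> N" using L U by simp_all
    have "2 * (i + j) + 1 = (2 * i + 1) + 2 * j" by simp
    then have "a (i + j) = coeff ((?D ^^ ((2 * i + 1) + 2 * j)) ?X) 0"
      by (metis a_def euler_poly_one_eq add_eq_0_iff_both_eq_0 one_neq_zero)
    then have "a (i + j) = coeff ((?D ^^ (2 * i + 1)) ((?D ^^ (2 * j)) ?X)) 0"
      by (simp only: funpow_add o_apply)
    also have "\<dots> = (\<Sum>k\<le>N. b k j * c i k)"
      by (simp add: expand [OF ij(2)] tanh_deriv_pow_sum tanh_deriv_pow_smult coeff_sum c_def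
          del: funpow.simps)
    also have "\<dots> = (L * U) $$ (i, j)"
      using ij by (simp add: L_def U_def scalar_prod_def atLeast0LessThan lessThan_Suc_atMost
          mult.commute)
    finally show "mat (n + 2) (n + 2) (\<lambda>(i, j). a (i + j)) $$ (i, j) = (L * U) $$ (i, j)"
      using ij by (simp add: N_def)
  qed (simp_all add: L_def U_def N_def)
  have det_U: "det U = (\<Prod>k\<le>N. fact (2 * k) / 4 ^ k)"
  proof -
    have "upper_triangular U" by (auto simp: U_def b_zero)
    then have "det U = prod_list (diag_mat U)" by (rule det_upper_triangular) (rule U)
    then show ?thesis
      by (simp add: prod_list_diag_prod U_def b_diag atLeast0LessThan lessThan_Suc_atMost)
  qed
  have det_L: "det L = (\<Prod>k\<le>N. fact (2 * k + 1) / (2 * 4 ^ k))"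
  proof -
    have "det L = prod_list (diag_mat L)"
      by (rule det_lower_triangular [OF _ L]) (simp add: L_def c_zero)
    then show ?thesis
      by (simp add: prod_list_diag_prod L_def c_diag atLeast0LessThan lessThan_Suc_atMost)
  qed
  have Lx: "L *\<^sub>v x = unit_vec (Suc N) 0"
  proof (rule eq_vecI)
    fix i assume "i < dim_vec (unit_vec (Suc N) 0)"
    then have i: "i \<le> N" by simp
    have "(L *\<^sub>v x) $ i = (\<Sum>k\<le>N. 2 / (2 * real k + 1) * c i k)"
      using i by (simp add: L_def x_def scalar_prod_def atLeast0LessThan lessThan_Suc_atMost
          mult.commute)
    also have "\<dots> = coeff ((?D ^^ (2 * i + 1))
        (\<Sum>k\<le>N. smult (2 / (2 * real k + 1)) (monom 1 (2 * k + 1)))) 0"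
      by (simp only: tanh_deriv_pow_sum tanh_deriv_pow_smult coeff_sum c_def coeff_smult)
    \<comment> \<open>One of the 2i + 1 steps is spent on the truncated series.\<close>
    also have "\<dots> = coeff ((?D ^^ (2 * i)) (1 - monom 1 (2 * N + 2))) 0"
      using tanh_deriv_truncated_artanh [of N] by (simp add: smult_monom funpow_swap1)
    also have "\<dots> = (if i = 0 then 1 else 0)"
    proof (cases i)
      case (Suc i')
      define q where "q = ?D (1 - monom 1 (2 * N + 2))"
      \<comment> \<open>\<open>q\<close> starts at X^(2N+1), and the 2i - 1 steps left are too few
        to bring that down to a constant.\<close>
      have "coeff q l = 0" if "l < 2 * N + 1" for l
        using that by (auto simp: q_def coeff_tanh_deriv)
      then have "coeff ((?D ^^ (2 * i' + 1)) q) 0 = 0"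
        using Suc i by (subst coeff_tanh_deriv_pow_zero) auto
      then show ?thesis by (simp add: Suc q_def funpow_swap1)
    qed simp
    finally show "(L *\<^sub>v x) $ i = unit_vec (Suc N) 0 $ i" using i by simp
  qed (simp add: L_def)
  have Uy: "transpose_mat U *\<^sub>v y = unit_vec (Suc N) 0"
  proof (rule eq_vecI)
    fix j assume "j < dim_vec (unit_vec (Suc N) 0)"
    then have j: "j \<le> N" by simp
    have "(transpose_mat U *\<^sub>v y) $ j = (\<Sum>k\<le>N. b k j)"
      using j by (simp add: U_def y_def scalar_prod_def atLeast0LessThan lessThan_Suc_atMost)
    \<comment> \<open>All basis monomials equal 1 at X = 1, so a column sum of \<open>U\<close> is a
      polynomial value there.\<close>
    also have "\<dots> = poly ((?D ^^ (2 * j)) ?X) 1"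
      by (simp add: expand [OF j] poly_sum poly_monom)
    also have "\<dots> = (if j = 0 then 1 else 0)"
      by (cases j) (simp_all add: poly_tanh_deriv_one)
    finally show "(transpose_mat U *\<^sub>v y) $ j = unit_vec (Suc N) 0 $ j" using j by simp
  qed (simp add: U_def)
  have pow16: "(16 :: real) ^ k = 4 ^ k * 4 ^ k" for k
    by (simp flip: power_mult_distrib)
  have "det U \<noteq> 0" by (simp add: det_U)
  then have minor: "hankel_det n (\<lambda>k. a (k + 2)) = det (L * U) * (y \<bullet> x)"
    using hankel_det_shift [of n a] hankel det_mat_delete_mult [OF L U _ x y _ Lx Uy] by simp
  have yx: "y \<bullet> x = 2 * odd_harm N"
    by (simp add: y_def x_def scalar_prod_def odd_harm_def sum_distrib_left atLeast0LessThan
        lessThan_Suc_atMost atLeast0AtMost)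
  define P where
    "P = (\<Prod>l=1..N. ((real l)\<^sup>2 * (2 * real l + 1) * (2 * real l - 1) / 4) ^ (N + 1 - l))"
  have "det (L * U) = (\<Prod>k\<le>N. 1 / 2 * (fact (2 * k) * fact (2 * k + 1) / 16 ^ k))"
    unfolding det_mult [OF L U] det_L det_U prod.distrib [symmetric]
    by (intro prod.cong) (simp_all add: pow16 mult_ac del: fact_Suc)
  \<comment> \<open>Each of the n + 2 diagonal entries of \<open>L\<close> contributes one 1/2; the
    2 in \<open>yx\<close> later cancels one of them.\<close>
  also have "\<dots> = (1 / 2) ^ (n + 2) * P"
    unfolding P_def prod.distrib prod_power_staircase prod_hankel_coeff_eq by (simp add: N_def)
  finally have "hankel_det n (\<lambda>k. a (k + 2)) = (1 / 2) ^ (n + 1) * odd_harm N * P"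
    unfolding minor yx by simp
  moreover have "(\<lambda>k. a (k + 2)) = (\<lambda>k. euler_poly (2 * k + 5) 1)"
    by (simp add: a_def eval_nat_numeral)
  moreover have "N + 1 = n + 2" by (simp add: N_def)
  ultimately show ?thesis unfolding P_def by (simp only: N_def)
qed

end
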